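(* Let $D=(V,A)$ be an acyclic digraph and let $F\subseteq V$. Then every convex set of $D$ containing $F$ is output exactly once by the procedure $\mathrm{CS}(D,F)$ (described in the context).
   Context: A set $X$ of vertices of an acyclic digraph $D$ is convex if $X\neq\emptyset$ and there is no directed path between two vertices of $X$ containing a vertex not in $X$. A vertex is a source (sink) if it has no in-neighbours (out-neighbours). For a vertex $s$, $D-s$ is the digraph obtained by deleting $s$. Procedure $\mathrm{CS}(D=(V,A),F)$: (1) output $V$; (2) for each vertex $s\in V\setminus F$ that is a source or sink of $D$, in turn: call $\mathrm{CS}(D-s,F)$, and then set $F:=F\cup\{s\}$ (so later recursive calls in this loop use the enlarged $F$). *)

theory Defs
  imports "Graph_Theory.Graph_Theory"
begin

definition acyclic_digraph :: "('a, 'b) pre_digraph \<Rightarrow> bool" where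
  "acyclic_digraph D \<longleftrightarrow> digraph D \<and> (\<nexists>p. pre_digraph.cycle D p)"

definition convex_set :: "('a, 'b) pre_digraph \<Rightarrow> 'a set \<Rightarrow> bool" where
  "convex_set D X \<longleftrightarrow> X \<subseteq> verts D \<and> X \<noteq> {} \<and>
     \<not> (\<exists>u\<in>X. \<exists>v\<in>X. \<exists>p. pre_digraph.apath D u p v \<and>
          (\<exists>w\<in>set (pre_digraph.awalk_verts D u p). w \<notin> X))"

definition is_source :: "('a, 'b) pre_digraph \<Rightarrow> 'a \<Rightarrow> bool" where
  "is_source D s \<longleftrightarrow> s \<in> verts D \<and> (\<nexists>u. u \<rightarrow>\<^bsub>D\<^esub> s)"

definition is_sink :: "('a, 'b) pre_digraph \<Rightarrow> 'a \<Rightarrow> bool" where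
  "is_sink D s \<longleftrightarrow> s \<in> verts D \<and> (\<nexists>u. s \<rightarrow>\<^bsub>D\<^esub> u)"

text \<open>
  The procedure does not prescribe the order in which its loop visits the sources and sinks, so
  it is modelled as a big-step relation: \<open>CS D F out\<close> says that \<open>out\<close> is the list of all
  sets output, in order and with repetitions, by some complete execution of the call on
  \<open>(D, F)\<close>. Each call may visit its vertices in any order \<open>ss\<close>.
  \<open>CS_loop D F ss out\<close> describes executing the loop for the remaining vertices
  \<open>ss\<close>, where \<open>F\<close> is the current value of the program variable.
\<close>

inductive CS :: "('a, 'b) pre_digraph \<Rightarrow> 'a set \<Rightarrow> 'a set list \<Rightarrow> bool"
  and CS_loop :: "('a, 'b) pre_digraph \<Rightarrow> 'a set \<Rightarrow> 'a list \<Rightarrow> 'a set list \<Rightarrow> bool"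
where
  call: "\<lbrakk>distinct ss; set ss = {s \<in> verts D - F. is_source D s \<or> is_sink D s};
          CS_loop D F ss out\<rbrakk> \<Longrightarrow> CS D F (verts D # out)"
| loop_done: "CS_loop D F [] []"
| loop_step: "\<lbrakk>CS (pre_digraph.del_vert D s) F out1; CS_loop D (F \<union> {s}) ss out2\<rbrakk>
          \<Longrightarrow> CS_loop D F (s # ss) (out1 @ out2)"

end

theory Submission
  imports Defs
begin

text \<open>
  Every set output by a call \<open>CS D F\<close> lies between \<open>F\<close> and the vertex set of \<open>D\<close>. Hence when the
  loop processes \<open>s\<close>, the recursive call on \<open>D - s\<close> outputs only sets avoiding \<open>s\<close>, while all later
  iterations output only sets containing \<open>s\<close>; so a convex set \<open>X\<close> is produced exactly in the
  iteration of the first processed \<open>s\<close> outside \<open>X\<close>. Such an \<open>s\<close> exists for every convex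
  \<open>X\<close> other than the whole vertex set: if \<open>w\<close> is a vertex outside \<open>X\<close>, pick a source from which \<open>w\<close>
  is reachable and a sink reachable from \<open>w\<close>; they cannot both lie in \<open>X\<close>, since joining the
  paths through \<open>w\<close> would violate convexity.
\<close>

lemma wf_imp_ex_minimal_below:
  assumes "wf r"
  shows "\<exists>m. (m, x) \<in> r\<^sup>* \<and> (\<forall>y. (y, m) \<notin> r)"
  using assms
proof (induction x rule: wf_induct_rule)
  case (less x)
  show ?case
  proof (cases "\<exists>y. (y, x) \<in> r")
    case True
    with less show ?thesis by (meson rtrancl.rtrancl_into_rtrancl)
  qed blast
qed

lemma (in fin_digraph) finite_arcs_ends: "finite (arcs_ends G)"
  by (simp add: arcs_ends_def)

locale acyclic_wf_digraph = wf_digraph +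
  assumes no_cycle: "\<nexists>p. cycle p"
begin

lemma not_closed_w: "\<not> closed_w p"
  using closed_w_imp_cycle no_cycle by blast

lemma acyclic_arcs_ends: "acyclic (arcs_ends G)"
proof (rule acyclicI, intro allI notI)
  fix x assume "x \<rightarrow>\<^sup>+ x"
  then obtain p where "awalk x p x" "p \<noteq> []" by (auto simp: reachable1_awalk)
  then have "closed_w p" by (auto simp: closed_w_def)
  then show False using not_closed_w by contradiction
qed

lemma apath_iff_awalk: "apath u p v \<longleftrightarrow> awalk u p v"
proof
  assume walk: "awalk u p v"
  then have "distinct (awalk_verts u p)" using awalk_cyc_decompE' not_closed_w by metis
  with walk show "apath u p v" by (simp add: apath_def)
qed (simp add: apath_def)

lemma convex_set_iff_reachable:
  "convex_set G X \<longleftrightarrow> X \<subseteq> verts G \<and> X \<noteq> {} \<and>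
    (\<forall>u\<in>X. \<forall>v\<in>X. \<forall>w. u \<rightarrow>\<^sup>* w \<longrightarrow> w \<rightarrow>\<^sup>* v \<longrightarrow> w \<in> X)"
proof -
  have "(\<exists>p. apath u p v \<and> w \<in> set (awalk_verts u p)) \<longleftrightarrow> u \<rightarrow>\<^sup>* w \<and> w \<rightarrow>\<^sup>* v" for u v w
  proof
    assume "u \<rightarrow>\<^sup>* w \<and> w \<rightarrow>\<^sup>* v"
    then obtain p q where walks: "awalk u p w" "awalk w q v" by (auto simp: reachable_awalk)
    have "w \<in> set (awalk_verts w q)" using walks(2) by (simp add: set_awalk_verts)
    then have "w \<in> set (awalk_verts u (p @ q))"
      by (simp add: set_awalk_verts_append[OF walks])
    moreover have "apath u (p @ q) v" using walks by (simp add: apath_iff_awalk)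
    ultimately show "\<exists>p. apath u p v \<and> w \<in> set (awalk_verts u p)" by blast
  qed (auto simp: apath_iff_awalk intro: awalk_verts_reachable_from awalk_verts_reachable_to)
  then show ?thesis unfolding convex_set_def by blast
qed

lemma acyclic_wf_digraph_del_vert: "acyclic_wf_digraph (del_vert s)"
proof (intro acyclic_wf_digraph.intro acyclic_wf_digraph_axioms.intro wf_digraph_del_vert)
  show "\<nexists>p. pre_digraph.cycle (del_vert s) p"
    using subgraph_cycle[OF subgraph_del_vert] no_cycle by blast
qed

lemma convex_set_del_vert:
  assumes "convex_set G X" and "s \<notin> X"
  shows "convex_set (del_vert s) X"
proof -
  interpret del: acyclic_wf_digraph "del_vert s" by (rule acyclic_wf_digraph_del_vert)
  have "u \<rightarrow>\<^sup>* v" if "u \<rightarrow>\<^sup>*\<^bsub>del_vert s\<^esub> v" for u v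
    using that subgraph_del_vert by (rule reachable_mono)
  moreover have "X \<subseteq> verts (del_vert s)"
    using assms by (auto simp: convex_set_def verts_del_vert)
  ultimately show ?thesis
    using assms(1) unfolding convex_set_iff_reachable del.convex_set_iff_reachable by meson
qed

end

locale acyclic_fin_digraph = acyclic_wf_digraph + fin_digraph
begin

lemma acyclic_fin_digraph_del_vert: "acyclic_fin_digraph (del_vert s)"
  by (intro acyclic_fin_digraph.intro acyclic_wf_digraph_del_vert fin_digraph_del_vert)

lemma ex_source_reaching:
  assumes "w \<in> verts G"
  shows "\<exists>s. is_source G s \<and> s \<rightarrow>\<^sup>* w"
proof -
  have "wf (arcs_ends G)" by (intro finite_acyclic_wf finite_arcs_ends acyclic_arcs_ends)
  then obtain s where "(s, w) \<in> (arcs_ends G)\<^sup>*" "\<forall>u. \<not> u \<rightarrow> s"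
    using wf_imp_ex_minimal_below by metis
  moreover from this have "s \<rightarrow>\<^sup>* w" using assms by (auto dest: rtranclD)
  ultimately show ?thesis by (auto simp: is_source_def dest: reachable_in_verts)
qed

lemma ex_sink_reachable:
  assumes "w \<in> verts G"
  shows "\<exists>t. is_sink G t \<and> w \<rightarrow>\<^sup>* t"
proof -
  have "wf ((arcs_ends G)\<inverse>)"
    by (intro finite_acyclic_wf_converse finite_arcs_ends acyclic_arcs_ends)
  then obtain t where "(w, t) \<in> (arcs_ends G)\<^sup>*" "\<forall>u. \<not> t \<rightarrow> u"
    using wf_imp_ex_minimal_below by (metis converse_iff rtrancl_converse)
  moreover from this have "w \<rightarrow>\<^sup>* t" using assms by (auto dest: rtranclD)
  ultimately show ?thesis by (auto simp: is_sink_def dest: reachable_in_verts)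
qed

lemma convex_set_eq_verts_iff:
  assumes "convex_set G X"
  shows "X = verts G \<longleftrightarrow> {s. is_source G s \<or> is_sink G s} \<subseteq> X"
proof
  assume ends: "{s. is_source G s \<or> is_sink G s} \<subseteq> X"
  have "verts G \<subseteq> X"
  proof
    fix w assume w: "w \<in> verts G"
    obtain s t where "is_source G s" "is_sink G t" and reach: "s \<rightarrow>\<^sup>* w" "w \<rightarrow>\<^sup>* t"
      using ex_source_reaching[OF w] ex_sink_reachable[OF w] by auto
    with ends have "s \<in> X" "t \<in> X" by auto
    with reach show "w \<in> X" using assms unfolding convex_set_iff_reachable by blast
  qed
  then show "X = verts G" using assms by (auto simp: convex_set_def)
qed (auto simp: is_source_def is_sink_def)

end

lemma acyclic_digraph_imp_acyclic_fin_digraph: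
  assumes "acyclic_digraph D"
  shows "acyclic_fin_digraph D"
proof -
  interpret digraph D using assms by (simp add: acyclic_digraph_def)
  show ?thesis using assms by unfold_locales (simp add: acyclic_digraph_def)
qed

lemma ex_CS_loop:
  assumes "\<And>s F. s \<in> set ss \<Longrightarrow> \<exists>out. CS (pre_digraph.del_vert D s) F out"
  shows "\<exists>out. CS_loop D F ss out"
  using assms
proof (induction ss arbitrary: F)
  case Nil
  show ?case using loop_done by blast
next
  case (Cons s ss)
  then obtain out1 out2
    where "CS (pre_digraph.del_vert D s) F out1" "CS_loop D (F \<union> {s}) ss out2"
    by (meson list.set_intros)
  then have "CS_loop D F (s # ss) (out1 @ out2)" by (rule loop_step)
  then show ?case ..
qed

lemma ex_CS:
  assumes "finite (verts D)"
  shows "\<exists>out. CS D F out"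
  using assms
proof (induction "card (verts D)" arbitrary: D F rule: less_induct)
  case less
  have recursive_call: "\<exists>out. CS (pre_digraph.del_vert D s) F' out" if "s \<in> verts D" for s F'
  proof (rule less.hyps)
    show "card (verts (pre_digraph.del_vert D s)) < card (verts D)"
      unfolding pre_digraph.verts_del_vert using less.prems that by (rule card_Diff1_less)
    show "finite (verts (pre_digraph.del_vert D s))"
      using less.prems by (simp add: pre_digraph.verts_del_vert)
  qed
  have "finite {s \<in> verts D - F. is_source D s \<or> is_sink D s}" using less.prems by simp
  then obtain ss where ss: "distinct ss" "set ss = {s \<in> verts D - F. is_source D s \<or> is_sink D s}"
    using finite_distinct_list by metis
  then obtain out where "CS_loop D F ss out" using ex_CS_loop[of ss D F] recursive_call by auto
  with ss have "CS D F (verts D # out)" by (rule call)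
  then show ?case ..
qed

definition CS_loop_invar :: "('a, 'b) pre_digraph \<Rightarrow> 'a set \<Rightarrow> 'a list \<Rightarrow> bool" where
  "CS_loop_invar D F ss \<longleftrightarrow> F \<subseteq> verts D \<and> distinct ss \<and> set ss \<subseteq> verts D - F"

lemma CS_loop_invar_ConsD:
  assumes "CS_loop_invar D F (s # ss)"
  shows "F \<subseteq> verts (pre_digraph.del_vert D s)" and "CS_loop_invar D (F \<union> {s}) ss"
  using assms by (auto simp: CS_loop_invar_def pre_digraph.verts_del_vert)

lemma CS_output_subset_verts:
  "CS D F out \<Longrightarrow> Y \<in> set out \<Longrightarrow> Y \<subseteq> verts D"
  "CS_loop D F ss out \<Longrightarrow> Y \<in> set out \<Longrightarrow> Y \<subseteq> verts D"
  by (induction rule: CS_CS_loop.inducts) (auto simp: pre_digraph.verts_del_vert)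

lemma subset_CS_output:
  "CS D F out \<Longrightarrow> F \<subseteq> verts D \<Longrightarrow> Y \<in> set out \<Longrightarrow> F \<subseteq> Y"
  "CS_loop D F ss out \<Longrightarrow> CS_loop_invar D F ss \<Longrightarrow> Y \<in> set out \<Longrightarrow> F \<subseteq> Y"
proof (induction rule: CS_CS_loop.inducts)
  case (call ss D F out)
  then have "CS_loop_invar D F ss" by (auto simp: CS_loop_invar_def)
  with call show ?case by auto
next
  case (loop_step D s F out1 ss out2)
  then show ?case using CS_loop_invar_ConsD[OF loop_step.prems(1)] by auto
qed simp

lemma count_list_CS_loop_step:
  assumes "CS (pre_digraph.del_vert D s) F out1" and "CS_loop D (F \<union> {s}) ss out2"
    and "CS_loop_invar D F (s # ss)"
  shows "count_list (out1 @ out2) X = (if s \<in> X then count_list out2 X else count_list out1 X)"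
proof (cases "s \<in> X")
  case True
  then have "X \<notin> set out1"
    using CS_output_subset_verts(1)[OF assms(1)] by (auto simp: pre_digraph.verts_del_vert)
  with True show ?thesis by (simp add: count_list_0_iff)
next
  case False
  then have "X \<notin> set out2"
    using subset_CS_output(2)[OF assms(2) CS_loop_invar_ConsD(2)[OF assms(3)]] by auto
  with False show ?thesis by (simp add: count_list_0_iff)
qed

lemma count_list_CS:
  "CS D F out \<Longrightarrow> acyclic_fin_digraph D \<Longrightarrow> F \<subseteq> verts D \<Longrightarrow> convex_set D X \<Longrightarrow> F \<subseteq> X \<Longrightarrow>
    count_list out X = 1"
  "CS_loop D F ss out \<Longrightarrow> acyclic_fin_digraph D \<Longrightarrow> CS_loop_invar D F ss \<Longrightarrow> convex_set D X \<Longrightarrow>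
    F \<subseteq> X \<Longrightarrow> count_list out X = (if set ss \<subseteq> X then 0 else 1)"
proof (induction rule: CS_CS_loop.inducts)
  case (call ss D F out)
  interpret acyclic_fin_digraph D by fact
  have "CS_loop_invar D F ss" using call.hyps(1,2) call.prems(2) by (auto simp: CS_loop_invar_def)
  then have "count_list out X = (if set ss \<subseteq> X then 0 else 1)" using call.IH call.prems by blast
  moreover have "set ss \<subseteq> X \<longleftrightarrow> X = verts D"
    unfolding convex_set_eq_verts_iff[OF call.prems(3)] call.hyps(2)
    using call.prems(4) by (auto simp: is_source_def is_sink_def)
  ultimately show ?case by auto
next
  case (loop_step D s F out1 ss out2)
  interpret acyclic_fin_digraph D by fact
  note invar = CS_loop_invar_ConsD[OF loop_step.prems(2)]
  have "count_list (out1 @ out2) X = (if s \<in> X then count_list out2 X else count_list out1 X)"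
    using loop_step.hyps loop_step.prems(2) by (rule count_list_CS_loop_step)
  moreover have "count_list out1 X = 1" if "s \<notin> X"
    using that acyclic_fin_digraph_del_vert invar(1) convex_set_del_vert loop_step.prems(3,4)
    by (intro loop_step.IH(1))
  moreover have "count_list out2 X = (if set ss \<subseteq> X then 0 else 1)" if "s \<in> X"
    using that invar(2) loop_step.prems(1,3,4) by (intro loop_step.IH(2)) auto
  ultimately show ?case by simp
qed simp

theorem theorem11:
  fixes D :: "('a, 'b) pre_digraph" and F :: "'a set"
  assumes "acyclic_digraph D" and "F \<subseteq> verts D"
  shows "(\<exists>out. CS D F out) \<and>
         (\<forall>out. CS D F out \<longrightarrow>
            (\<forall>X. convex_set D X \<and> F \<subseteq> X \<longrightarrow> count_list out X = 1))"
proof (intro conjI allI impI)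
  interpret acyclic_fin_digraph D
    using assms(1) by (rule acyclic_digraph_imp_acyclic_fin_digraph)
  show "\<exists>out. CS D F out" using finite_verts by (rule ex_CS)
  fix out X
  assume "CS D F out" and "convex_set D X \<and> F \<subseteq> X"
  then show "count_list out X = 1"
    using acyclic_fin_digraph_axioms assms(2) by (intro count_list_CS(1)) auto
qed

end
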